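(* Let $f:[0,+\infty)\to[0,+\infty)$ be continuous and let $k$, $K$, $m$, $M$ be as in the context. For $\rho>0$ put $$f^{0,\rho}:=\sup\Bigl\{\frac{f(u)}{\rho}: 0\le u\le\rho\Bigr\},\qquad f_{\rho/4,\rho}:=\inf\Bigl\{\frac{f(u)}{\rho}:\rho/4\le u\le\rho\Bigr\}.$$ Assume that one of the following conditions holds. (H1) There exist $\rho_1,\rho_2\in(0,+\infty)$ with $\rho_1<\rho_2/4$ such that $f^{0,\rho_1}\le m$ and $f_{\rho_2/4,\rho_2}\ge M$. (H2) There exist $\rho_1,\rho_2\in(0,+\infty)$ with $\rho_1<\rho_2$ such that $f_{\rho_1/4,\rho_1}\ge M$ and $f^{0,\rho_2}\le m$. Then the integral equation $$u(t)=\int_0^1 k(t,s)f(u(s))\,ds,\qquad t\in[0,1],$$ has a positive solution in $K$, i.e. a solution $u\in K$ with $\|u\|>0$.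
   Context: $C[0,1]$ carries the norm $\|u\|=\max_{t\in[0,1]}|u(t)|$. The kernel $k:[0,1]\times[0,1]\to[0,+\infty)$ is the Green's function of $u''+y=0$, $u(0)=u(1)=0$: $k(t,s)=s(1-t)$ if $s\le t$ and $k(t,s)=t(1-s)$ if $s>t$. The cone $K$ is $$K=\Bigl\{u\in C[0,1]: u\ge0,\ \min_{t\in[1/4,3/4]}u(t)\ge\tfrac14\|u\|\Bigr\}.$$ The constants $m,M>0$ are given by $$\frac1m=\sup_{t\in[0,1]}\int_0^1k(t,s)\,ds,\qquad \frac1M=\inf_{t\in[1/4,3/4]}\int_{1/4}^{3/4}k(t,s)\,ds.$$ *)

theory Defs
  imports "HOL-Analysis.Analysis"
begin

text \<open>
  Elements of \<open>C[0,1]\<close> are represented by functions on \<^typ>\<open>real\<close> that are continuous on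
  \<open>{0..1}\<close>; their values outside \<open>{0..1}\<close> play no role. On such functions the maxima and
  minima over compact intervals exist and are written as suprema and infima, because
  \<^const>\<open>Max\<close> and \<^const>\<open>Min\<close> are meaningful for finite sets only.
\<close>

definition max_norm :: "(real \<Rightarrow> real) \<Rightarrow> real" where
  "max_norm u = (SUP t\<in>{0..1}. \<bar>u t\<bar>)"

definition green :: "real \<Rightarrow> real \<Rightarrow> real" where
  "green t s = (if s \<le> t then s * (1 - t) else t * (1 - s))"

definition cone_K :: "(real \<Rightarrow> real) set" where
  "cone_K = {u. continuous_on {0..1} u \<and> (\<forall>t\<in>{0..1}. 0 \<le> u t) \<and>
                (INF t\<in>{1/4..3/4}. u t) \<ge> 1/4 * max_norm u}"

definition const_m :: real where
  "const_m = 1 / (SUP t\<in>{0..1}. integral {0..1} (\<lambda>s. green t s))"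

definition const_M :: real where
  "const_M = 1 / (INF t\<in>{1/4..3/4}. integral {1/4..3/4} (\<lambda>s. green t s))"

definition f_sup :: "(real \<Rightarrow> real) \<Rightarrow> real \<Rightarrow> real" where
  "f_sup f \<rho> = (SUP u\<in>{0..\<rho>}. f u / \<rho>)"

definition f_inf :: "(real \<Rightarrow> real) \<Rightarrow> real \<Rightarrow> real" where
  "f_inf f \<rho> = (INF u\<in>{\<rho>/4..\<rho>}. f u / \<rho>)"

end

theory Submission
  imports Defs "HOL-Complex_Analysis.Great_Picard"
begin

text \<open>
  The problem is the autonomous boundary value problem \<open>u'' + f u = 0\<close>, \<open>u 0 = u 1 = 0\<close>, and a
  solution symmetric about \<open>1/2\<close> is found by shooting from the midpoint: solve
  \<open>v 0 = R\<close>, \<open>v' 0 = 0\<close>, \<open>v'' = - f v\<close> and choose \<open>R\<close> with \<open>v (1/2) = 0\<close>. Since \<open>m = 8\<close>, the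
  condition \<open>f \<le> m R\<close> on \<open>{0..R}\<close> forces \<open>v (1/2) \<ge> 0\<close>; since \<open>M = 16\<close>, the condition
  \<open>f \<ge> M R\<close> on \<open>{R/4..R}\<close> and the concavity of \<open>v\<close> force \<open>v (1/2) \<le> 0\<close>. Hence an intermediate value
  of \<open>R\<close> works under either hypothesis. As \<open>f\<close> is merely continuous, the initial value problem need
  not have unique solutions; it is replaced by Tonelli's delayed equation, whose solution depends
  continuously on \<open>R\<close>, and the delay is sent to \<open>0\<close> with the theorem of Arzela and Ascoli.
\<close>

subsection \<open>Twofold integration on the half interval\<close>

text \<open>
  The truncated kernel keeps the domain of integration fixed and gives \<open>0\<close> for \<open>t \<le> 0\<close>, which
  supplies the constant initial history of the delayed equation.
\<close>
definition double_primitive :: "(real \<Rightarrow> real) \<Rightarrow> real \<Rightarrow> real" where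
  "double_primitive g t = integral {0..1/2} (\<lambda>s. max (t - s) 0 * g s)"

lemma double_primitive_integrable:
  assumes "continuous_on {0..1/2} g"
  shows "(\<lambda>s. max (t - s) 0 * g s) integrable_on {0..1/2::real}"
  by (intro integrable_continuous_real continuous_intros assms)

lemma double_primitive_nonpos:
  assumes "t \<le> 0"
  shows "double_primitive g t = 0"
proof -
  have "double_primitive g t = integral {0..1/2::real} (\<lambda>s. 0)"
    unfolding double_primitive_def
    by (intro Henstock_Kurzweil_Integration.integral_cong) (use assms in auto)
  then show ?thesis by simp
qed

text \<open>The kernel vanishes for \<open>s > t\<close>, so only the past of \<open>g\<close>
  enters; the method of steps for the delayed equation rests on this.\<close>

lemma double_primitive_cong:
  assumes "\<And>s. 0 \<le> s \<Longrightarrow> s \<le> 1/2 \<Longrightarrow> s \<le> t \<Longrightarrow> g s = g' s"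
  shows "double_primitive g t = double_primitive g' t"
  unfolding double_primitive_def
  by (intro Henstock_Kurzweil_Integration.integral_cong) (use assms in \<open>auto simp: max_def\<close>)

lemma double_primitive_le:
  assumes "continuous_on {0..1/2} g" "continuous_on {0..1/2} g'"
    and "\<And>s. 0 \<le> s \<Longrightarrow> s \<le> 1/2 \<Longrightarrow> s \<le> t \<Longrightarrow> g s \<le> g' s"
  shows "double_primitive g t \<le> double_primitive g' t"
  unfolding double_primitive_def
proof (intro integral_le double_primitive_integrable assms)
  show "max (t - s) 0 * g s \<le> max (t - s) 0 * g' s" if "s \<in> {0..1/2}" for s
    using assms(3)[of s] that by (cases "s \<le> t") (auto intro: mult_left_mono)
qed

lemma double_primitive_const:
  assumes "0 \<le> t" "t \<le> 1/2"
  shows "double_primitive (\<lambda>s. c) t = c * t\<^sup>2 / 2"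
proof -
  have "((\<lambda>s. (t - s) * c) has_integral (- c * (t - t)\<^sup>2 / 2 - - c * (t - 0)\<^sup>2 / 2)) {0..t}"
    by (rule fundamental_theorem_of_calculus[OF assms(1)])
      (auto intro!: derivative_eq_intros simp: field_simps
        simp flip: has_real_derivative_iff_has_vector_derivative)
  then have 1: "((\<lambda>s. max (t - s) 0 * c) has_integral c * t\<^sup>2 / 2) {0..t}"
    by (subst has_integral_cong[of _ _ "\<lambda>s. (t - s) * c"]) (auto simp: max_def)
  have 2: "((\<lambda>s. max (t - s) 0 * c) has_integral 0) {t..1/2}"
    by (rule has_integral_is_0) auto
  show ?thesis
    unfolding double_primitive_def
    using has_integral_combine[OF assms 1 2] by (intro integral_unique) simp
qed

lemma double_primitive_mono:
  assumes "continuous_on {0..1/2} g" "\<And>s. 0 \<le> s \<Longrightarrow> s \<le> 1/2 \<Longrightarrow> 0 \<le> g s" "t \<le> t'"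
  shows "double_primitive g t \<le> double_primitive g t'"
  unfolding double_primitive_def
  by (intro integral_le double_primitive_integrable mult_right_mono assms) (use assms in auto)

text \<open>The function \<open>double_primitive g\<close> is convex on \<open>t >= 0\<close> and
  vanishes at \<open>0\<close>, so its quotient by \<open>t\<close> increases. The kernel already
  has this property for each fixed \<open>s >= 0\<close>.\<close>

lemma double_primitive_slope_mono:
  assumes "continuous_on {0..1/2} g" "\<And>s. 0 \<le> s \<Longrightarrow> s \<le> 1/2 \<Longrightarrow> 0 \<le> g s" "0 \<le> a" "a \<le> b"
  shows "b * double_primitive g a \<le> a * double_primitive g b"
proof -
  have "b * double_primitive g a = integral {0..1/2} (\<lambda>s. b * (max (a - s) 0 * g s))"
    unfolding double_primitive_def by simp
  also have "\<dots> \<le> integral {0..1/2} (\<lambda>s. a * (max (b - s) 0 * g s))"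
  proof (intro integral_le integrable_on_mult_right double_primitive_integrable assms)
    fix s :: real assume s: "s \<in> {0..1/2}"
    have "b * max (a - s) 0 \<le> a * max (b - s) 0"
    proof (cases "s \<le> a")
      case True
      have "b * (a - s) \<le> a * (b - s)"
        using mult_right_mono[OF assms(4), of s] s by (simp add: algebra_simps)
      then show ?thesis using True assms(4) by simp
    qed (use assms in auto)
    from mult_right_mono[OF this, of "g s"]
    show "b * (max (a - s) 0 * g s) \<le> a * (max (b - s) 0 * g s)"
      using assms(2)[of s] s by (simp add: mult.assoc)
  qed
  also have "\<dots> = a * double_primitive g b"
    unfolding double_primitive_def by simp
  finally show ?thesis .
qed

text \<open>The constant depends on \<open>g\<close> only through its bound \<open>B\<close>, which
  later gives a Lipschitz constant common to all delays.\<close>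

lemma double_primitive_lipschitz:
  assumes "continuous_on {0..1/2} g" "\<And>s. 0 \<le> s \<Longrightarrow> s \<le> 1/2 \<Longrightarrow> \<bar>g s\<bar> \<le> B"
  shows "\<bar>double_primitive g t - double_primitive g t'\<bar> \<le> B * \<bar>t - t'\<bar>"
proof -
  have B: "0 \<le> B" using assms(2)[of 0] by linarith
  have "double_primitive g t - double_primitive g t' =
      integral {0..1/2} (\<lambda>s. max (t - s) 0 * g s - max (t' - s) 0 * g s)"
    unfolding double_primitive_def
    by (simp add: double_primitive_integrable[OF assms(1)] Henstock_Kurzweil_Integration.integral_diff)
  also have "norm \<dots> \<le> B * \<bar>t - t'\<bar> * (1/2 - 0)"
  proof (rule integral_bound)
    show "continuous_on {0..1/2} (\<lambda>s. max (t - s) 0 * g s - max (t' - s) 0 * g s)"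
      by (intro continuous_intros assms)
    fix s :: real assume s: "s \<in> {0..1/2}"
    have "\<bar>max (t - s) 0 - max (t' - s) 0\<bar> * \<bar>g s\<bar> \<le> \<bar>t - t'\<bar> * B"
      using assms(2)[of s] s by (intro mult_mono) auto
    then show "norm (max (t - s) 0 * g s - max (t' - s) 0 * g s) \<le> B * \<bar>t - t'\<bar>"
      by (simp add: mult.commute flip: left_diff_distrib right_diff_distrib abs_mult)
  qed simp
  also have "\<dots> \<le> B * \<bar>t - t'\<bar>" using B by simp
  finally show ?thesis by simp
qed

subsection \<open>Tonelli's delayed equation\<close>

text \<open>Method of steps: the iterates started from the constant \<open>R\<close> are jointly
  continuous in \<open>(R, t)\<close>, and each one extends the range on which the iteration is
  stationary by the delay \<open>h\<close>. Finitely many iterates reach \<open>1/2\<close>, so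
  continuity in \<open>R\<close> survives without any passage to a limit.\<close>

lemma delayed_equation_solution:
  fixes F :: "real \<Rightarrow> real"
  assumes F: "continuous_on UNIV F" and h: "0 < h"
  obtains V where "continuous_on UNIV (\<lambda>p. V (fst p) (snd p))"
    and "\<And>R t. t \<le> 1/2 \<Longrightarrow> V R t = R - double_primitive (\<lambda>s. F (V R (s - h))) t"
proof -
  define U where "U = rec_nat (\<lambda>R t. R) (\<lambda>_ W R t. R - double_primitive (\<lambda>s. F (W R (s - h))) t)"
  have U0: "U 0 R t = R" 
    and US: "U (Suc k) R t = R - double_primitive (\<lambda>s. F (U k R (s - h))) t" for k R t
    by (simp_all add: U_def)
  have cont: "continuous_on UNIV (\<lambda>p. U k (fst p) (snd p))" for k
  proof (induction k)
    case 0
    then show ?case by (auto simp: U0 intro!: continuous_intros)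
  next
    case (Suc k)
    have "continuous_on UNIV (\<lambda>q. U k (fst (fst q)) (snd q - h))"
      by (rule continuous_on_compose2[OF Suc, of _ "\<lambda>q. (fst (fst q), snd q - h)", simplified])
        (intro continuous_intros)
    then have "continuous_on UNIV (\<lambda>q. F (U k (fst (fst q)) (snd q - h)))"
      by (intro continuous_on_compose2[OF F]) auto
    then have c: "continuous_on UNIV (\<lambda>q::(real \<times> real) \<times> real.
        max (snd (fst q) - snd q) 0 * F (U k (fst (fst q)) (snd q - h)))"
      by (intro continuous_intros)
    have "continuous_on UNIV (\<lambda>p. integral (cbox 0 (1/2))
        (\<lambda>s. max (snd p - s) 0 * F (U k (fst p) (s - h))))"
      by (rule integral_continuous_on_param)
        (use c in \<open>auto simp: case_prod_unfold intro: continuous_on_subset\<close>)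
    then show ?case
      by (auto simp: US double_primitive_def intro!: continuous_intros)
  qed
  have stable: "U (Suc k) R t = U k R t" if "t \<le> k * h" for k R t
    using that
  proof (induction k arbitrary: t)
    case 0
    then show ?case by (simp add: US U0 double_primitive_nonpos)
  next
    case (Suc k)
    \<comment> \<open>For \<open>s <= t <= Suc k * h\<close> the delayed argument
      \<open>s - h\<close> is at most \<open>k * h\<close>, where the induction hypothesis
      applies.\<close>
    have "double_primitive (\<lambda>s. F (U (Suc k) R (s - h))) t = double_primitive (\<lambda>s. F (U k R (s - h))) t"
      by (rule double_primitive_cong) (use Suc in \<open>auto simp: algebra_simps\<close>)
    then show ?case by (simp only: US)
  qed
  obtain N :: nat where N: "1/2 < N * h"
    using reals_Archimedean3[OF h] by blast
  show ?thesis
  proof (rule that[of "U N"])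
    show "U N R t = R - double_primitive (\<lambda>s. F (U N R (s - h))) t" if "t \<le> 1/2" for R t
      using stable[of t N R] that N by (simp add: US)
  qed (rule cont)
qed

text \<open>Starting height \<open>p\<close> leaves the solution nonnegative at \<open>1/2\<close>
  and starting height \<open>q\<close> makes it nonpositive there, so a height between them, in
  whichever order they lie, hits zero.\<close>

lemma delayed_equation_zero:
  fixes F :: "real \<Rightarrow> real"
  assumes F: "continuous_on UNIV F" and nonneg: "\<And>x. 0 \<le> F x" and h: "0 < h"
    and p: "\<And>x. x \<le> p \<Longrightarrow> F x \<le> 8 * p"
    and q: "0 < q" "\<And>x. q/4 \<le> x \<Longrightarrow> x \<le> q \<Longrightarrow> 16 * q \<le> F x"
  obtains R v where "min p q \<le> R" "R \<le> max p q" "continuous_on UNIV v" "v (1/2) = 0"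
    "\<And>t. t \<le> 1/2 \<Longrightarrow> v t = R - double_primitive (\<lambda>s. F (v (s - h))) t"
proof -
  obtain V where V: "continuous_on UNIV (\<lambda>p. V (fst p) (snd p))"
    and eq: "\<And>R t. t \<le> 1/2 \<Longrightarrow> V R t = R - double_primitive (\<lambda>s. F (V R (s - h))) t"
    using delayed_equation_solution[OF F h] by metis
  have contR: "continuous_on S (\<lambda>R. V R (1/2))" for S
    by (rule continuous_on_compose2[OF V, of _ "\<lambda>R. (R, 1/2)", simplified]) (intro continuous_intros)
  have contt: "continuous_on S (V R)" for S R
    by (rule continuous_on_compose2[OF V, of _ "\<lambda>t. (R, t)", simplified]) (intro continuous_intros)
  have contF: "continuous_on S (\<lambda>s. F (V R (s - h)))" for S R
    by (intro continuous_on_compose2[OF F] continuous_on_compose2[OF contt[of UNIV R]] continuous_intros) auto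
  have VR: "V R t \<le> R" if "t \<le> 1/2" for R t
  proof -
    have "double_primitive (\<lambda>s. F (V R (s - h))) 0 \<le> double_primitive (\<lambda>s. F (V R (s - h))) (max 0 t)"
      by (rule double_primitive_mono) (auto simp: contF nonneg)
    then have "0 \<le> double_primitive (\<lambda>s. F (V R (s - h))) t"
      by (cases "t \<le> 0") (auto simp: double_primitive_nonpos max_def)
    then show ?thesis using eq[OF that, of R] by simp
  qed
  \<comment> \<open>The solution stays below its starting height \<open>p\<close>, so the bound on
    \<open>F\<close> applies along it; the constant \<open>8 * p\<close> integrates twice to exactly
    \<open>p\<close> over the half interval.\<close>
  have "double_primitive (\<lambda>s. F (V p (s - h))) (1/2) \<le> double_primitive (\<lambda>s. 8 * p) (1/2)"
    by (rule double_primitive_le) (use h in \<open>auto simp: contF intro!: p VR\<close>)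
  then have pos: "0 \<le> V p (1/2)"
    by (simp add: eq double_primitive_const power2_eq_square)
  have anti: "V R t' \<le> V R t" if "t \<le> t'" "t' \<le> 1/2" for R t t'
    using double_primitive_mono[OF contF, of R t t'] that nonneg by (simp add: eq)
  \<comment> \<open>The value \<open>5/16\<close> slightly exceeds the time \<open>sqrt (3/32)\<close> at which \<open>q * (1 - 8 * t\<^sup>2)\<close> reaches \<open>q / 4\<close>.\<close>
  have quarter: "V q (5/16) \<le> q/4"
  proof (rule ccontr)
    assume "\<not> ?thesis"
    then have *: "q/4 < V q (5/16)" by simp
    have "double_primitive (\<lambda>s. 16 * q) (5/16) \<le> double_primitive (\<lambda>s. F (V q (s - h))) (5/16)"
    proof (rule double_primitive_le)
      fix s :: real assume "0 \<le> s" "s \<le> 1/2" "s \<le> 5/16"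
      then show "16 * q \<le> F (V q (s - h))"
        using anti[of "s - h" "5/16" q] VR[of "s - h" q] h * by (intro q(2)) auto
    qed (auto simp: contF)
    \<comment> \<open>The right-hand side equals \<open>7/32 * q\<close>, which is below
      \<open>q/4\<close>.\<close>
    then have "V q (5/16) \<le> q - 16 * q * (5/16)\<^sup>2 / 2"
      by (simp add: eq double_primitive_const)
    then show False using * q(1) by (simp add: power2_eq_square)
  qed
  \<comment> \<open>A drop of at least \<open>3/4 * q\<close> by time \<open>5/16\<close> becomes,
    by concavity of the solution, a drop of at least \<open>6/5 * q\<close> by time
    \<open>1/2\<close>.\<close>
  have "1/2 * double_primitive (\<lambda>s. F (V q (s - h))) (5/16)
      \<le> 5/16 * double_primitive (\<lambda>s. F (V q (s - h))) (1/2)"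
    by (rule double_primitive_slope_mono) (auto simp: contF nonneg)
  then have neg: "V q (1/2) \<le> 0"
    using quarter q(1) by (simp add: eq)
  have "\<exists>R. min p q \<le> R \<and> R \<le> max p q \<and> V R (1/2) = 0"
    using IVT'[of "\<lambda>R. V R (1/2)" q 0 p] IVT2'[of "\<lambda>R. V R (1/2)" q 0 p] pos neg contR
    by (cases "q \<le> p") fastforce+
  then obtain R where "min p q \<le> R" "R \<le> max p q" "V R (1/2) = 0" by blast
  then show ?thesis using that[of R "V R"] contt eq by blast
qed

subsection \<open>Removing the delay\<close>

text \<open>All delayed solutions take values between \<open>0\<close> and \<open>max p q\<close> on
  the half-line up to \<open>1/2\<close>, hence share a Lipschitz constant and have a uniformly
  convergent subsequence. The lower bound \<open>min p q\<close> on the heights passes to the limit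
  and later excludes the zero solution.\<close>

lemma midpoint_shooting:
  fixes F :: "real \<Rightarrow> real"
  assumes F: "continuous_on UNIV F" and nonneg: "\<And>x. 0 \<le> F x"
    and p: "\<And>x. x \<le> p \<Longrightarrow> F x \<le> 8 * p"
    and q: "0 < q" "\<And>x. q/4 \<le> x \<Longrightarrow> x \<le> q \<Longrightarrow> 16 * q \<le> F x"
  obtains R u where "min p q \<le> R" "continuous_on {0..1/2} u" "u (1/2) = 0"
    "\<And>t. t \<in> {0..1/2} \<Longrightarrow> u t = R - double_primitive (\<lambda>s. F (u s)) t"
proof -
  define h where "h n = 1 / real (Suc n)" for n
  have h: "0 < h n" for n by (simp add: h_def)
  have "\<forall>n. \<exists>R v. min p q \<le> R \<and> R \<le> max p q \<and> continuous_on UNIV v \<and> v (1/2) = 0 \<and>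
      (\<forall>t\<le>1/2. v t = R - double_primitive (\<lambda>s. F (v (s - h n))) t)"
    using delayed_equation_zero[OF F nonneg h p q] by metis
  then obtain R v where R: "\<And>n. min p q \<le> R n" "\<And>n. R n \<le> max p q"
    and cont: "\<And>n. continuous_on UNIV (v n)" and zero: "\<And>n. v n (1/2) = 0"
    and eq: "\<And>n t. t \<le> 1/2 \<Longrightarrow> v n t = R n - double_primitive (\<lambda>s. F (v n (s - h n))) t"
    by metis
  have contF: "continuous_on S (\<lambda>s. F (v n (s - h n)))" for S n
    by (intro continuous_on_compose2[OF F] continuous_on_compose2[OF cont] continuous_intros) auto
  \<comment> \<open>Each \<open>v n\<close> is decreasing and ends at zero.\<close>
  have v_nonneg: "0 \<le> v n t" if "t \<le> 1/2" for n t
    using double_primitive_mono[OF contF, of n t "1/2"] that nonneg zero[of n] by (simp add: eq)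
  have v_start: "v n t \<le> v n 0" if "0 \<le> t" "t \<le> 1/2" for n t
    using double_primitive_mono[OF contF, of n 0 t] that nonneg by (simp add: eq)
  have v0: "v n t = R n" if "t \<le> 0" for n t
    using that by (simp add: eq double_primitive_nonpos)
  have v_le: "v n t \<le> max p q" if "t \<le> 1/2" for n t
    using v_start[of t n] v0[of t n] v0[of 0 n] R(2)[of n] that by (cases "t \<le> 0") auto
  obtain B where B: "\<And>x. 0 \<le> x \<Longrightarrow> x \<le> max p q \<Longrightarrow> \<bar>F x\<bar> \<le> B"
  proof -
    have "bounded (F ` {0..max p q})"
      by (intro compact_imp_bounded compact_continuous_image continuous_on_subset[OF F]) auto
    then show ?thesis using that unfolding bounded_iff by fastforce
  qed
  have FB: "\<bar>F (v n (s - h n))\<bar> \<le> B" if "s \<le> 1/2" for n s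
    using v_nonneg[of "s - h n" n] v_le[of "s - h n" n] that h[of n] by (intro B) auto
  have B0: "0 \<le> B" using FB[of 0 0] by linarith
  have lip: "\<bar>v n t - v n t'\<bar> \<le> B * \<bar>t - t'\<bar>" if "t \<le> 1/2" "t' \<le> 1/2" for n t t'
    using double_primitive_lipschitz[OF contF, of n B t t'] FB that
    by (simp add: eq abs_minus_commute)
  obtain u k where u: "continuous_on {0..1/2} u" and k: "strict_mono (k :: nat \<Rightarrow> nat)"
    and unif: "\<And>e. 0 < e \<Longrightarrow> \<exists>N. \<forall>n x. n \<ge> N \<and> x \<in> {0..1/2::real} \<longrightarrow> norm (v (k n) x - u x) < e"
  proof (rule Arzela_Ascoli[of "{0..1/2::real}" v "max p q"])
    fix x e :: real assume x: "x \<in> {0..1/2}" "0 < e"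
    \<comment> \<open>The denominator \<open>B + 1\<close> covers the case
      \<open>B = 0\<close>.\<close>
    have "norm (v n x - v n y) < e" if "y \<in> {0..1/2}" "norm (x - y) < e / (B + 1)" for n y
    proof -
      have "norm (v n x - v n y) \<le> (B + 1) * \<bar>x - y\<bar>"
        using lip[of x y n] x that by (auto simp: algebra_simps)
      also have "\<dots> < e" using that B0 by (simp add: field_simps)
      finally show ?thesis .
    qed
    then show "\<exists>d>0. \<forall>n y. y \<in> {0..1/2} \<and> norm (x - y) < d \<longrightarrow> norm (v n x - v n y) < e"
      using B0 x by (intro exI[of _ "e / (B + 1)"]) auto
  qed (use v_nonneg v_le in auto)
  have lim: "(\<lambda>n. v (k n) s) \<longlonglongrightarrow> u s" if "s \<in> {0..1/2}" for s
    unfolding LIMSEQ_iff using unif that by meson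
  have hlim: "(\<lambda>n. h (k n)) \<longlonglongrightarrow> 0"
  proof -
    have "h \<longlonglongrightarrow> 0"
      using LIMSEQ_inverse_real_of_nat by (simp add: h_def[abs_def] inverse_eq_divide)
    from LIMSEQ_subseq_LIMSEQ[OF this k] show ?thesis by (simp add: o_def)
  qed
  have lim_delay: "(\<lambda>n. v (k n) (s - h (k n))) \<longlonglongrightarrow> u s" if s: "s \<in> {0..1/2}" for s
  proof -
    \<comment> \<open>The shift costs at most \<open>B * h (k n)\<close>, uniformly in the solution;
      the Lipschitz bound also holds at negative times, which \<open>s - h (k n)\<close> may
      reach.\<close>
    have "(\<lambda>n. v (k n) (s - h (k n)) - v (k n) s) \<longlonglongrightarrow> 0"
    proof (rule Lim_null_comparison)
      show "(\<lambda>n. B * h (k n)) \<longlonglongrightarrow> 0" using tendsto_mult_left[OF hlim, of B] by simp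
      show "\<forall>\<^sub>F n in sequentially. norm (v (k n) (s - h (k n)) - v (k n) s) \<le> B * h (k n)"
      proof (intro always_eventually allI)
        show "norm (v (k n) (s - h (k n)) - v (k n) s) \<le> B * h (k n)" for n
          using lip[of "s - h (k n)" s "k n"] s h[of "k n"] by simp
      qed
    qed
    from tendsto_add[OF this lim[OF s]] show ?thesis by simp
  qed
  have DP: "(\<lambda>n. double_primitive (\<lambda>s. F (v (k n) (s - h (k n)))) t) \<longlonglongrightarrow> double_primitive (\<lambda>s. F (u s)) t" for t
    unfolding double_primitive_def
  proof (rule dominated_convergence(2))
    show "(\<lambda>s. max (t - s) 0 * F (v (k n) (s - h (k n)))) integrable_on {0..1/2}" for n
      by (rule double_primitive_integrable[OF contF])
    show "(\<lambda>s. max (t - s) 0 * B) integrable_on {0..1/2}"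
      by (rule double_primitive_integrable) auto
    show "norm (max (t - s) 0 * F (v (k n) (s - h (k n)))) \<le> max (t - s) 0 * B"
      if "s \<in> {0..1/2}" for n s
      using FB[of s "k n"] that by (auto simp: abs_mult intro!: mult_left_mono)
    show "(\<lambda>n. max (t - s) 0 * F (v (k n) (s - h (k n)))) \<longlonglongrightarrow> max (t - s) 0 * F (u s)"
      if "s \<in> {0..1/2}" for s
      by (intro tendsto_mult_left continuous_on_tendsto_compose[OF F lim_delay[OF that]]) auto
  qed
  \<comment> \<open>The heights are the values at time \<open>0\<close>, so they converge along the
    same subsequence.\<close>
  have Rlim: "(\<lambda>n. R (k n)) \<longlonglongrightarrow> u 0"
    using lim[of 0] by (simp add: v0)
  show ?thesis
  proof (rule that[OF _ u])
    show "min p q \<le> u 0"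
      using Rlim R(1) by (intro LIMSEQ_le_const) auto
    show "u (1/2) = 0"
      using lim[of "1/2"] by (simp add: zero LIMSEQ_const_iff)
    show "u t = u 0 - double_primitive (\<lambda>s. F (u s)) t" if "t \<in> {0..1/2}" for t
    proof (rule LIMSEQ_unique[OF lim[OF that]])
      show "(\<lambda>n. v (k n) t) \<longlonglongrightarrow> u 0 - double_primitive (\<lambda>s. F (u s)) t"
        using tendsto_diff[OF Rlim DP, of t] that by (simp add: eq)
    qed
  qed
qed

subsection \<open>The Green's function\<close>

lemma green_eq: "green t s = min s t - s * t"
  by (auto simp: green_def min_def algebra_simps)

lemma continuous_on_green [continuous_intros]:
  "continuous_on S g \<Longrightarrow> continuous_on S (\<lambda>s. green t (g s))"
  unfolding green_eq by (intro continuous_intros)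

text \<open>Folding the Green's function about \<open>1/2\<close> turns it into a difference of two
  truncated kernels of \<open>double_primitive\<close>, at \<open>1/2\<close> and at the distance of
  \<open>t\<close> from the midpoint.\<close>

lemma green_symmetrized:
  assumes "0 \<le> s" "s \<le> 1/2" "0 \<le> t" "t \<le> 1"
  shows "green t (1/2 + s) + green t (1/2 - s) = max (1/2 - s) 0 - max (\<bar>t - 1/2\<bar> - s) 0"
  using assms by (auto simp: green_eq min_def max_def abs_if algebra_simps)

lemma integral_symmetrize:
  fixes G :: "real \<Rightarrow> real"
  assumes "continuous_on {0..1} G"
  shows "integral {0..1} G = integral {0..1/2} (\<lambda>s. G (1/2 + s) + G (1/2 - s))"
proof -
  have c: "continuous_on {0..1/2} (\<lambda>s. G (1/2 + s))" "continuous_on {0..1/2} (\<lambda>s. G (1/2 - s))"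
    by (intro continuous_on_compose2[OF assms] continuous_intros; force)+
  have "integral {1/2..1} G = integral {0..1/2} (\<lambda>s. G (1/2 + s))"
    using integral_shift_Icc_real[of 0 "1/2" G "1/2"] by (simp add: o_def)
  moreover have "integral {0..1/2} G = integral {0..1/2} (\<lambda>s. G (1/2 - s))"
    using Henstock_Kurzweil_Integration.integral_reflect_real[of "1/2" 0 "\<lambda>s. G (1/2 - s)"]
      integral_shift_Icc_real[of "-1/2" 0 G "1/2"] by (simp add: o_def)
  moreover have "integral {0..1} G = integral {0..1/2} G + integral {1/2..1} G"
    using Henstock_Kurzweil_Integration.integral_combine[of 0 "1/2" 1 G]
      integrable_continuous_real[OF assms] by simp
  ultimately show ?thesis
    using c by (simp add: Henstock_Kurzweil_Integration.integral_add integrable_continuous_real)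
qed

text \<open>This translates the integral equation for symmetric functions into the shooting
  equation, with height \<open>double_primitive g (1/2)\<close>.\<close>

lemma integral_green_symmetric:
  assumes g: "continuous_on {0..1/2} g" and t: "t \<in> {0..1}"
  shows "integral {0..1} (\<lambda>s. green t s * g \<bar>s - 1/2\<bar>) =
    double_primitive g (1/2) - double_primitive g \<bar>t - 1/2\<bar>"
proof -
  have "continuous_on {0..1} (\<lambda>s. green t s * g \<bar>s - 1/2\<bar>)"
    by (intro continuous_intros continuous_on_compose2[OF g]) (auto simp: abs_if)
  then have "integral {0..1} (\<lambda>s. green t s * g \<bar>s - 1/2\<bar>) =
      integral {0..1/2} (\<lambda>s. green t (1/2 + s) * g \<bar>s\<bar> + green t (1/2 - s) * g \<bar>s\<bar>)"
    by (subst integral_symmetrize) simp_all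
  also have "\<dots> = integral {0..1/2} (\<lambda>s. max (1/2 - s) 0 * g s - max (\<bar>t - 1/2\<bar> - s) 0 * g s)"
    by (intro Henstock_Kurzweil_Integration.integral_cong)
      (use t in \<open>auto simp: green_symmetrized simp flip: distrib_right left_diff_distrib\<close>)
  also have "\<dots> = double_primitive g (1/2) - double_primitive g \<bar>t - 1/2\<bar>"
    unfolding double_primitive_def
    by (intro Henstock_Kurzweil_Integration.integral_diff double_primitive_integrable g)
  finally show ?thesis .
qed

section \<open>The constants m and M\<close>

lemma integral_green_half: "integral {0..1} (green (1/2)) = 1/8"
  using integral_green_symmetric[of "\<lambda>_. 1" "1/2"]
  by (simp add: double_primitive_const double_primitive_nonpos power2_eq_square)

lemma integral_green_quarter: "integral {1/4..3/4} (green (1/4)) = 1/16"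
proof -
  have "((\<lambda>s::real. 1/4 * (1 - s)) has_integral (- ((1 - 3/4)\<^sup>2) / 8 - - ((1 - 1/4)\<^sup>2) / 8)) {1/4..3/4}"
    by (rule fundamental_theorem_of_calculus)
      (auto intro!: derivative_eq_intros simp: field_simps
        simp flip: has_real_derivative_iff_has_vector_derivative)
  then have "(green (1/4) has_integral 1/16) {1/4..3/4}"
    by (subst has_integral_cong[of _ _ "\<lambda>s. 1/4 * (1 - s)"])
      (auto simp: green_eq min_def power2_eq_square algebra_simps)
  then show ?thesis by (rule integral_unique)
qed

text \<open>The supremum is at least its value \<open>1/8\<close> at the midpoint; the crude bound
  \<open>1\<close> shows that it is finite.\<close>

lemma const_m_le: "const_m \<le> 8"
proof -
  have "integral {0..1} (green t) \<le> 1" if "t \<in> {0..1}" for t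
  proof -
    have "integral {0..1} (green t) \<le> integral {0..1} (\<lambda>s::real. 1)"
    proof (rule integral_le)
      show "green t integrable_on {0..1}"
        by (intro integrable_continuous_real continuous_on_green continuous_on_id)
      show "green t s \<le> 1" if "s \<in> {0..1}" for s
      proof -
        have "0 \<le> s * t" using that \<open>t \<in> {0..1}\<close> by simp
        then show ?thesis using that by (auto simp: green_eq min_def)
      qed
    qed (intro integrable_continuous_real continuous_intros)
    then show ?thesis by simp
  qed
  then have "bdd_above ((\<lambda>t. integral {0..1} (green t)) ` {0..1})"
    by (intro bdd_aboveI2)
  then have "1/8 \<le> (SUP t\<in>{0..1}. integral {0..1} (green t))"
    by (intro cSUP_upper2[of _ _ "1/2"]) (simp_all add: integral_green_half)
  then show ?thesis by (simp add: const_m_def field_simps)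
qed

text \<open>The endpoint \<open>t = 1/4\<close> bounds the infimum above by \<open>1/16\<close>. The
  bound \<open>1/32\<close> keeps it positive, so that taking reciprocals reverses the
  inequality.\<close>

lemma const_M_ge: "16 \<le> const_M"
proof -
  have low: "1/32 \<le> integral {1/4..3/4} (green t)" if t: "t \<in> {1/4..3/4}" for t
  proof -
    have "integral {1/4..3/4} (\<lambda>s::real. 1/16) \<le> integral {1/4..3/4} (green t)"
    proof (rule integral_le)
      show "green t integrable_on {1/4..3/4}"
        by (intro integrable_continuous_real continuous_on_green continuous_on_id)
      show "1/16 \<le> green t s" if "s \<in> {1/4..3/4}" for s
        using mult_mono[of "1/4" s "1/4" "1 - t"] mult_mono[of "1/4" t "1/4" "1 - s"] that t
        by (auto simp: green_def)
    qed (intro integrable_continuous_real continuous_intros)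
    then show ?thesis by simp
  qed
  then have "bdd_below ((\<lambda>t. integral {1/4..3/4} (green t)) ` {1/4..3/4})"
    by (intro bdd_belowI2)
  then have "(INF t\<in>{1/4..3/4}. integral {1/4..3/4} (green t)) \<le> 1/16"
    by (intro cINF_lower2[of _ _ "1/4"]) (simp_all add: integral_green_quarter)
  moreover have "1/32 \<le> (INF t\<in>{1/4..3/4}. integral {1/4..3/4} (green t))"
    by (intro cINF_greatest low) auto
  ultimately show ?thesis by (simp add: const_M_def field_simps)
qed

section \<open>Pointwise bounds on f\<close>

lemma f_sup_bound:
  assumes "continuous_on {0..} f" "0 < \<rho>" "f_sup f \<rho> \<le> c" "0 \<le> x" "x \<le> \<rho>"
  shows "f x \<le> c * \<rho>"
proof -
  have "bdd_above ((\<lambda>x. f x / \<rho>) ` {0..\<rho>})"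
    by (intro bounded_imp_bdd_above compact_imp_bounded compact_continuous_image continuous_intros
        continuous_on_subset[OF assms(1)]) (use assms in auto)
  then have "f x / \<rho> \<le> f_sup f \<rho>"
    unfolding f_sup_def using assms by (intro cSUP_upper) auto
  then have "f x / \<rho> \<le> c" using assms by linarith
  then show ?thesis using assms by (simp add: field_simps)
qed

lemma f_inf_bound:
  assumes "continuous_on {0..} f" "0 < \<rho>" "c \<le> f_inf f \<rho>" "\<rho>/4 \<le> x" "x \<le> \<rho>"
  shows "c * \<rho> \<le> f x"
proof -
  have "bdd_below ((\<lambda>x. f x / \<rho>) ` {\<rho>/4..\<rho>})"
    by (intro bounded_imp_bdd_below compact_imp_bounded compact_continuous_image continuous_intros
        continuous_on_subset[OF assms(1)]) (use assms in auto)
  then have "f_inf f \<rho> \<le> f x / \<rho>"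
    unfolding f_inf_def using assms by (intro cINF_lower) auto
  then have "c \<le> f x / \<rho>" using assms by linarith
  then show ?thesis using assms by (simp add: field_simps)
qed

section \<open>Reflection about the midpoint and conclusion\<close>

lemma symmetric_solution:
  assumes g: "continuous_on {0..1/2} g" "\<And>s. 0 \<le> s \<Longrightarrow> s \<le> 1/2 \<Longrightarrow> 0 \<le> g s"
    and u: "continuous_on {0..1/2} u" "u (1/2) = 0" "0 < R"
    and eq: "\<And>t. t \<in> {0..1/2} \<Longrightarrow> u t = R - double_primitive g t"
  shows "(\<lambda>t. u \<bar>t - 1/2\<bar>) \<in> cone_K" "max_norm (\<lambda>t. u \<bar>t - 1/2\<bar>) = R"
    "\<And>t. t \<in> {0..1} \<Longrightarrow> u \<bar>t - 1/2\<bar> = integral {0..1} (\<lambda>s. green t s * g \<bar>s - 1/2\<bar>)"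
proof -
  have anti: "u t' \<le> u t" if "0 \<le> t" "t \<le> t'" "t' \<le> 1/2" for t t'
    using double_primitive_mono[OF g, of t t'] that by (simp add: eq)
  have u0: "u 0 = R" by (simp add: eq double_primitive_nonpos)
  have range: "0 \<le> u \<bar>t - 1/2\<bar>" "u \<bar>t - 1/2\<bar> \<le> R" if "t \<in> {0..1}" for t
    using anti[of "\<bar>t - 1/2\<bar>" "1/2"] anti[of 0 "\<bar>t - 1/2\<bar>"] that u(2) u0 by (auto simp: abs_if)
  show norm: "max_norm (\<lambda>t. u \<bar>t - 1/2\<bar>) = R"
    unfolding max_norm_def
  proof (rule cSup_eq_maximum)
    show "R \<in> (\<lambda>t. \<bar>u \<bar>t - 1/2\<bar>\<bar>) ` {0..1}"
      using u0 u(3) by (intro image_eqI[of _ _ "1/2"]) auto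
  qed (use range in auto)
  \<comment> \<open>Since \<open>double_primitive g (1/2) = R\<close>, this even gives
    \<open>u (1/4) >= R/2\<close>.\<close>
  have "1/2 * double_primitive g (1/4) \<le> 1/4 * double_primitive g (1/2)"
    by (rule double_primitive_slope_mono) (use g in auto)
  then have quarter: "R/4 \<le> u (1/4)"
    using u(2,3) by (simp add: eq)
  have "1/4 * R \<le> (INF t\<in>{1/4..3/4}. u \<bar>t - 1/2\<bar>)"
  proof (rule cINF_greatest)
    show "1/4 * R \<le> u \<bar>t - 1/2\<bar>" if "t \<in> {1/4..3/4}" for t
      using anti[of "\<bar>t - 1/2\<bar>" "1/4"] quarter that by (auto simp: abs_if split: if_splits)
  qed simp
  moreover have "continuous_on {0..1} (\<lambda>t. u \<bar>t - 1/2\<bar>)"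
    by (intro continuous_on_compose2[OF u(1)] continuous_intros) (auto simp: abs_if)
  ultimately show "(\<lambda>t. u \<bar>t - 1/2\<bar>) \<in> cone_K"
    using range norm by (auto simp: cone_K_def)
  show "u \<bar>t - 1/2\<bar> = integral {0..1} (\<lambda>s. green t s * g \<bar>s - 1/2\<bar>)" if "t \<in> {0..1}" for t
    using eq[of "1/2"] eq[of "\<bar>t - 1/2\<bar>"] u(2) that
    by (subst integral_green_symmetric[OF g(1) that]) (auto simp: abs_if)
qed

theorem theorem1p0p7:
  fixes f :: "real \<Rightarrow> real"
  assumes "continuous_on {0..} f"
    and "\<And>x. x \<ge> 0 \<Longrightarrow> f x \<ge> 0"
    and "(\<exists>\<rho>\<^sub>1>0. \<exists>\<rho>\<^sub>2>0. \<rho>\<^sub>1 < \<rho>\<^sub>2 / 4 \<and> f_sup f \<rho>\<^sub>1 \<le> const_m \<and> f_inf f \<rho>\<^sub>2 \<ge> const_M) \<or>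
         (\<exists>\<rho>\<^sub>1>0. \<exists>\<rho>\<^sub>2>0. \<rho>\<^sub>1 < \<rho>\<^sub>2 \<and> f_inf f \<rho>\<^sub>1 \<ge> const_M \<and> f_sup f \<rho>\<^sub>2 \<le> const_m)"
  shows "\<exists>u\<in>cone_K. max_norm u > 0 \<and>
           (\<forall>t\<in>{0..1}. u t = integral {0..1} (\<lambda>s. green t s * f (u s)))"
proof -
  \<comment> \<open>Under (H1) these are \<open>\<rho>\<^sub>1\<close> and
    \<open>\<rho>\<^sub>2\<close>, under (H2) they are \<open>\<rho>\<^sub>2\<close> and
    \<open>\<rho>\<^sub>1\<close>.\<close>
  obtain p q where pq: "0 < p" "0 < q" "f_sup f p \<le> 8" "16 \<le> f_inf f q"
    using assms(3) const_m_le const_M_ge by (meson order_trans)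
  \<comment> \<open>Delayed solutions may become negative while shooting, so \<open>f\<close> is
    extended by the constant \<open>f 0\<close>; this keeps \<open>F\<close> continuous and
    nonnegative and extends the bound \<open>8 * p\<close> to all \<open>x <= p\<close>.\<close>
  define F where "F x = f (max 0 x)" for x
  have F: "continuous_on UNIV F"
    unfolding F_def by (intro continuous_on_compose2[OF assms(1)] continuous_intros) auto
  obtain R u where R: "min p q \<le> R" and u: "continuous_on {0..1/2} u" "u (1/2) = 0"
    and eq: "\<And>t. t \<in> {0..1/2} \<Longrightarrow> u t = R - double_primitive (\<lambda>s. F (u s)) t"
  proof (rule midpoint_shooting[of F p q])
    show "F x \<le> 8 * p" if "x \<le> p" for x
      unfolding F_def using that pq by (intro f_sup_bound[OF assms(1)]) auto
    show "16 * q \<le> F x" if "q/4 \<le> x" "x \<le> q" for x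
      unfolding F_def using that pq by (intro f_inf_bound[OF assms(1)]) auto
  qed (use F assms(2) pq in \<open>auto simp: F_def\<close>)
  have Fu: "continuous_on {0..1/2} (\<lambda>s. F (u s))"
    by (intro continuous_on_compose2[OF F u(1)]) auto
  have R0: "0 < R" using R pq by auto
  define w where "w t = u \<bar>t - 1/2\<bar>" for t
  have w: "w \<in> cone_K" "max_norm w = R"
    "\<And>t. t \<in> {0..1} \<Longrightarrow> w t = integral {0..1} (\<lambda>s. green t s * F (w s))"
    using symmetric_solution[OF Fu _ u R0 eq] assms(2) by (auto simp: w_def[abs_def] F_def)
  have "integral {0..1} (\<lambda>s. green t s * F (w s)) = integral {0..1} (\<lambda>s. green t s * f (w s))" for t
    using w(1) by (intro Henstock_Kurzweil_Integration.integral_cong) (simp add: F_def cone_K_def)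
  then show ?thesis using w R0 by auto
qed

end
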